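(* For the unitary matrix $$u=\begin{pmatrix}1&0&0\\0&\frac{\sqrt3}{2}&\frac12\\0&-\frac12&\frac{\sqrt3}{2}\end{pmatrix}\in\mathbb{M}_3(\mathbb{C})$$ one has $\Delta^{(3)}\neq u\Delta^{(3)}u^*$ and $\alpha\left(\Delta^{(3)},u\Delta^{(3)}u^*\right)=0$. Moreover, for every $n\ge3$ there exists a unitary $u\in\mathbb{M}_n(\mathbb{C})$ such that $\Delta^{(n)}\neq u\Delta^{(n)}u^*$ and $\alpha\left(\Delta^{(n)},u\Delta^{(n)}u^*\right)=0$.
   Context: $\Delta^{(n)}$ denotes the algebra of diagonal matrices in $\mathbb{M}_n(\mathbb{C})$. Interior angle (taken with respect to $E_0(X)=\frac1n\operatorname{Tr}(X)\mathbb{I}_n$): view $\mathbb{M}_n(\mathbb{C})$ as a Hilbert space with inner product $\langle X,Y\rangle_\tau=\frac1n\operatorname{Tr}(X^*Y)$, and let $\mathbb{M}_n(\mathbb{C})$ act on it by left multiplication. For a unital $C^*$-subalgebra $\mathcal{C}\subseteq\mathbb{M}_n(\mathbb{C})$ let $e_{\mathcal{C}}\in\mathcal{B}(\mathbb{M}_n(\mathbb{C}))$ be the Jones projection $X\mapsto E_{\mathcal{C}}(X)$, where $E_{\mathcal{C}}$ is the trace-preserving conditional expectation onto $\mathcal{C}$ (equivalently, $e_{\mathcal{C}}$ is the orthogonal projection onto $\mathcal{C}$), and let $e_1:=e_{\mathbb{C}\mathbb{I}_n}$. Let $\tilde{E}:\mathcal{B}(\mathbb{M}_n(\mathbb{C}))\to\mathbb{M}_n(\mathbb{C})$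 be the dual conditional expectation, i.e. the linear map determined by $\tilde{E}(xe_1y)=\frac1{n^2}xy$ for $x,y\in\mathbb{M}_n(\mathbb{C})$. (Identifying $A\otimes B$ with the operator $X\mapsto AXB^T$, one has $\tilde{E}(A\otimes B)=\frac1n\operatorname{Tr}(B)A$.) For $S,T\in\mathcal{B}(\mathbb{M}_n(\mathbb{C}))$ put $\langle S,T\rangle:=\tilde{E}(S^*T)$ and $\|S\|_{\sim}:=\|\tilde{E}(S^*S)\|^{1/2}$, with the operator norm on $\mathbb{M}_n(\mathbb{C})$. For unital $C^*$-subalgebras $\mathcal{C},\mathcal{D}\neq\mathbb{C}\mathbb{I}_n$, $\alpha(\mathcal{C},\mathcal{D})$ is the unique element of $[0,\pi/2]$ with $$\cos\alpha(\mathcal{C},\mathcal{D})=\frac{\|\langle e_{\mathcal{C}}-e_1,\,e_{\mathcal{D}}-e_1\rangle\|}{\|e_{\mathcal{C}}-e_1\|_{\sim}\,\|e_{\mathcal{D}}-e_1\|_{\sim}}.$$ *)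

theory Defs
  imports "HOL-Analysis.Analysis"
begin

type_synonym 'n cmat = "complex^'n^'n"

definition cscale :: "complex \<Rightarrow> ('n::finite) cmat \<Rightarrow> 'n cmat" where
  "cscale c X = (\<chi> i j. c * X $ i $ j)"

definition adjm :: "('n::finite) cmat \<Rightarrow> 'n cmat" where
  "adjm X = (\<chi> i j. cnj (X $ j $ i))"

definition unitary :: "('n::finite) cmat \<Rightarrow> bool" where
  "unitary u \<longleftrightarrow> adjm u ** u = mat 1 \<and> u ** adjm u = mat 1"

definition positive :: "('n::finite) cmat \<Rightarrow> bool" where
  "positive X \<longleftrightarrow> (\<exists>Y. X = adjm Y ** Y)"

definition op_norm :: "('n::finite) cmat \<Rightarrow> real" where
  "op_norm X = onorm (\<lambda>v. X *v v)"

text \<open>Subspaces are automatically norm closed in finite dimension.\<close>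

definition unital_cstar_subalgebra :: "('n::finite) cmat set \<Rightarrow> bool" where
  "unital_cstar_subalgebra C \<longleftrightarrow>
     mat 1 \<in> C \<and>
     (\<forall>X\<in>C. \<forall>Y\<in>C. X + Y \<in> C \<and> X ** Y \<in> C) \<and>
     (\<forall>c. \<forall>X\<in>C. cscale c X \<in> C) \<and>
     (\<forall>X\<in>C. adjm X \<in> C)"

definition scalars :: "('n::finite) cmat set" where
  "scalars = range mat"

definition diagonals :: "('n::finite) cmat set" where
  "diagonals = {X. \<forall>i j. i \<noteq> j \<longrightarrow> X $ i $ j = 0}"

definition conj_alg :: "('n::finite) cmat \<Rightarrow> 'n cmat set \<Rightarrow> 'n cmat set" where
  "conj_alg u C = (\<lambda>X. u ** X ** adjm u) ` C"

text \<open>An element of the algebra of operators on \<open>M_n(C)\<close> is a complex linear map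
  \<^typ>\<open>'n cmat \<Rightarrow> 'n cmat\<close>; the composition \<open>\<circ>\<close> is the product.\<close>

definition operators :: "(('n::finite) cmat \<Rightarrow> 'n cmat) set" where
  "operators = {T. Vector_Spaces.linear cscale cscale T}"

definition tau_inner :: "('n::finite) cmat \<Rightarrow> 'n cmat \<Rightarrow> complex" where
  "tau_inner X Y = trace (adjm X ** Y) / of_nat CARD('n)"

definition op_adjoint :: "(('n::finite) cmat \<Rightarrow> 'n cmat) \<Rightarrow> 'n cmat \<Rightarrow> 'n cmat" where
  "op_adjoint S = (THE S'. \<forall>X Y. tau_inner (S X) Y = tau_inner X (S' Y))"

definition conditional_expectation ::
    "('n::finite) cmat set \<Rightarrow> ('n cmat \<Rightarrow> 'n cmat) \<Rightarrow> bool" where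
  "conditional_expectation C E \<longleftrightarrow>
     Vector_Spaces.linear cscale cscale E \<and>
     range E \<subseteq> C \<and>
     (\<forall>X\<in>C. E X = X) \<and>
     (\<forall>A\<in>C. \<forall>B\<in>C. \<forall>X. E (A ** X ** B) = A ** E X ** B) \<and>
     (\<forall>X. positive X \<longrightarrow> positive (E X))"

definition jones_projection :: "('n::finite) cmat set \<Rightarrow> 'n cmat \<Rightarrow> 'n cmat" where
  "jones_projection C =
     (THE E. conditional_expectation C E \<and> (\<forall>X. trace (E X) = trace X))"

definition e1 :: "('n::finite) cmat \<Rightarrow> 'n cmat" where
  "e1 = jones_projection scalars"

text \<open>The matrices \<open>x\<close>, \<open>y\<close> act by left multiplication, so \<open>x e\<^sub>1 y\<close> is the operator
  \<open>X \<mapsto> x e\<^sub>1(y X)\<close>. Extensionality fixes the value off the linear maps, so that the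
  description has exactly one solution.\<close>

definition dual_expectation :: "(('n::finite) cmat \<Rightarrow> 'n cmat) \<Rightarrow> 'n cmat" where
  "dual_expectation =
     (THE F. F \<in> extensional operators \<and>
        (\<forall>S\<in>operators. \<forall>T\<in>operators. F (\<lambda>X. S X + T X) = F S + F T) \<and>
        (\<forall>c. \<forall>S\<in>operators. F (\<lambda>X. cscale c (S X)) = cscale c (F S)) \<and>
        (\<forall>x y. F (\<lambda>X. x ** e1 (y ** X)) = cscale (1 / (of_nat CARD('n))\<^sup>2) (x ** y)))"

definition op_inner ::
    "(('n::finite) cmat \<Rightarrow> 'n cmat) \<Rightarrow> ('n cmat \<Rightarrow> 'n cmat) \<Rightarrow> 'n cmat" where
  "op_inner S T = dual_expectation (op_adjoint S \<circ> T)"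

definition tilde_norm :: "(('n::finite) cmat \<Rightarrow> 'n cmat) \<Rightarrow> real" where
  "tilde_norm S = sqrt (op_norm (op_inner S S))"

text \<open>Meaningful for unital C*-subalgebras other than \<^const>\<open>scalars\<close>.\<close>

definition interior_angle :: "('n::finite) cmat set \<Rightarrow> 'n cmat set \<Rightarrow> real" where
  "interior_angle C D =
     (let S = (\<lambda>X. jones_projection C X - e1 X);
          T = (\<lambda>X. jones_projection D X - e1 X)
      in THE a. a \<in> {0..pi/2} \<and>
           cos a = op_norm (op_inner S T) / (tilde_norm S * tilde_norm T))"

lemma adjm_adjm [simp]: "adjm (adjm X) = X"
  by (simp add: adjm_def vec_eq_iff)

lemma adjm_mult: "adjm (X ** Y) = adjm Y ** adjm X"
  by (simp add: adjm_def vec_eq_iff matrix_matrix_mult_def mult.commute)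

lemma adjm_mat [simp]: "adjm (mat c) = mat (cnj c)"
  by (auto simp: adjm_def vec_eq_iff mat_def)

lemma mat_mult: "mat c ** X = cscale c X" "X ** mat c = cscale c X"
  by (simp_all add: vec_eq_iff mat_def cscale_def matrix_matrix_mult_def
        if_distrib[of "\<lambda>x. x * _"] if_distrib[of "\<lambda>x. _ * x"] cong: if_cong)

lemma mat_mult_add_sub:
  fixes A B C :: "('n::finite) cmat"
  shows "(A + B) ** C = A ** C + B ** C" "C ** (A + B) = C ** A + C ** B"
    "(A - B) ** C = A ** C - B ** C" "C ** (A - B) = C ** A - C ** B"
  by (simp_all add: vec_eq_iff matrix_matrix_mult_def algebra_simps sum.distrib sum_subtractf)

lemma unital_cstar_subalgebra_scalars: "unital_cstar_subalgebra scalars"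
proof -
  have "mat a + mat b = (mat (a + b) :: 'a cmat)" "mat a ** mat b = (mat (a * b) :: 'a cmat)"
       "cscale a (mat b) = (mat (a * b) :: 'a cmat)" for a b :: complex
    by (simp_all add: mat_mult) (simp_all add: vec_eq_iff mat_def cscale_def)
  then show ?thesis
    unfolding unital_cstar_subalgebra_def scalars_def by auto
qed

lemma unital_cstar_subalgebra_diagonals: "unital_cstar_subalgebra diagonals"
proof -
  have "X ** Y \<in> diagonals" if "X \<in> diagonals" "Y \<in> diagonals" for X Y :: "'a cmat"
    using that unfolding diagonals_def matrix_matrix_mult_def
    by (auto intro!: sum.neutral) metis
  then show ?thesis
    unfolding unital_cstar_subalgebra_def
    by (auto simp: diagonals_def mat_def cscale_def adjm_def)
qed

lemma unital_cstar_subalgebra_conj_alg: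
  assumes "unitary u" "unital_cstar_subalgebra C"
  shows "unital_cstar_subalgebra (conj_alg u C)"
proof -
  have u: "adjm u ** u = mat 1" "u ** adjm u = mat 1" using assms by (auto simp: unitary_def)
  have C: "mat 1 \<in> C" "\<And>X Y. X \<in> C \<Longrightarrow> Y \<in> C \<Longrightarrow> X + Y \<in> C"
    "\<And>X Y. X \<in> C \<Longrightarrow> Y \<in> C \<Longrightarrow> X ** Y \<in> C" "\<And>c X. X \<in> C \<Longrightarrow> cscale c X \<in> C"
    "\<And>X. X \<in> C \<Longrightarrow> adjm X \<in> C"
    using assms(2) by (auto simp: unital_cstar_subalgebra_def)
  let ?f = "\<lambda>X. u ** X ** adjm u"
  have f1: "mat 1 = ?f (mat 1)" using u by simp
  have f2: "?f X + ?f Y = ?f (X + Y)" for X Y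
    by (simp add: mat_mult_add_sub)
  have f3: "?f X ** ?f Y = ?f (X ** Y)" for X Y
  proof -
    have "?f X ** ?f Y = u ** X ** (adjm u ** u) ** Y ** adjm u"
      by (simp only: matrix_mul_assoc)
    then show ?thesis by (simp add: u matrix_mul_assoc)
  qed
  have f4: "cscale c (?f X) = ?f (cscale c X)" for c X
    by (metis mat_mult matrix_mul_assoc)
  have f5: "adjm (?f X) = ?f (adjm X)" for X
    by (simp add: adjm_mult matrix_mul_assoc)
  have "mat 1 \<in> ?f ` C" using f1 C(1) by (rule image_eqI)
  then show ?thesis
    unfolding unital_cstar_subalgebra_def conj_alg_def
    using C by (auto simp: f2 f3 f4 f5)
qed

lemma diagonals_ne_scalars:
  assumes "CARD('n::finite) \<ge> 2"
  shows "(diagonals :: 'n cmat set) \<noteq> scalars"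
proof
  assume eq: "(diagonals :: 'n cmat set) = scalars"
  obtain i j :: 'n where "i \<noteq> j"
    using assms card_2_iff' ex_card by (metis UNIV_I)
  let ?D = "(\<chi> k l. if k = i \<and> l = i then 1 else 0) :: 'n cmat"
  have "?D \<in> scalars" unfolding eq[symmetric] by (auto simp: diagonals_def)
  then obtain c where c: "?D = mat c" by (auto simp: scalars_def)
  then have "?D $ i $ i = mat c $ i $ i" "?D $ j $ j = mat c $ j $ j" by simp_all
  then show False using \<open>i \<noteq> j\<close> by (simp add: mat_def)
qed

lemma conj_alg_ne_scalars:
  assumes "unitary u" "C \<noteq> scalars"
  shows "conj_alg u C \<noteq> scalars"
proof
  assume eq: "conj_alg u C = scalars"
  have u: "adjm u ** u = mat 1" "u ** adjm u = mat 1" using assms by (auto simp: unitary_def)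
  have inv: "adjm u ** (u ** X ** adjm u) ** u = X" for X
  proof -
    have "adjm u ** (u ** X ** adjm u) ** u = (adjm u ** u) ** X ** (adjm u ** u)"
      by (simp only: matrix_mul_assoc)
    then show ?thesis by (simp add: u)
  qed
  have sc: "adjm u ** mat c ** u = mat c" "u ** mat c ** adjm u = mat c" for c
    by (metis mat_mult matrix_mul_assoc u matrix_mul_lid matrix_mul_rid)+
  have "C = (\<lambda>X. adjm u ** X ** u) ` conj_alg u C"
    by (simp add: conj_alg_def image_image inv)
  also have "\<dots> = scalars" unfolding eq by (simp add: scalars_def image_image sc)
  finally show False using assms by simp
qed

lemma trace_cscale: "trace (cscale c X) = c * trace X"
  by (simp add: trace_def cscale_def sum_distrib_left)

lemma trace_adjm_mult: "trace (adjm X ** Y) = (\<Sum>i\<in>UNIV. \<Sum>j\<in>UNIV. cnj (X $ j $ i) * Y $ j $ i)"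
  by (simp add: trace_def adjm_def matrix_matrix_mult_def)

lemma trace_adjm_self_eq_0:
  fixes X :: "('n::finite) cmat"
  assumes "trace (adjm X ** X) = 0" shows "X = 0"
proof -
  have "trace (adjm X ** X) = of_real (\<Sum>i\<in>UNIV. \<Sum>j\<in>UNIV. (cmod (X $ j $ i))\<^sup>2)"
    unfolding trace_adjm_mult of_real_sum complex_norm_square by (simp add: mult.commute)
  then have "(\<Sum>i\<in>UNIV. \<Sum>j\<in>UNIV. (cmod (X $ j $ i))\<^sup>2) = 0"
    using assms by (metis of_real_eq_0_iff)
  then show ?thesis
    by (simp add: sum_nonneg_eq_0_iff sum_nonneg vec_eq_iff)
qed

lemma jones_projection_eqI:
  assumes C: "unital_cstar_subalgebra C"
    and E: "conditional_expectation C E" "\<And>X. trace (E X) = trace X"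
  shows "jones_projection C = E"
  unfolding jones_projection_def
proof (rule the_equality)
  show "conditional_expectation C E \<and> (\<forall>X. trace (E X) = trace X)" using E by simp
next
  fix F assume F: "conditional_expectation C F \<and> (\<forall>X. trace (F X) = trace X)"
  have tr: "trace (A ** G X) = trace (A ** X)"
    if "A \<in> C" "conditional_expectation C G" "\<And>X. trace (G X) = trace X" for A G X
  proof -
    have "G (A ** X ** mat 1) = A ** G X ** mat 1"
      using that C unfolding conditional_expectation_def unital_cstar_subalgebra_def by blast
    then show ?thesis using that(3)[of "A ** X"] by simp
  qed
  show "F = E"
  proof
    fix X
    have mem: "F X \<in> C" "E X \<in> C" using F E by (auto simp: conditional_expectation_def)
    have m: "cscale (-1) (E X) = - E X" by (simp add: cscale_def vec_eq_iff)
    have D: "F X - E X \<in> C"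
      using C mem m unfolding unital_cstar_subalgebra_def by (metis diff_conv_add_uminus)
    then have A: "adjm (F X - E X) \<in> C" using C by (auto simp: unital_cstar_subalgebra_def)
    have "trace (adjm (F X - E X) ** (F X - E X)) = 0"
      using tr[OF A, of F X] tr[OF A, of E X] F E
      by (simp add: mat_mult_add_sub trace_sub)
    then show "F X = E X" using trace_adjm_self_eq_0 by fastforce
  qed
qed

lemma e1_eq: "e1 = (\<lambda>X :: ('n::finite) cmat. mat (trace X / of_nat CARD('n)))"
proof -
  let ?E = "\<lambda>X :: 'n cmat. mat (trace X / of_nat CARD('n)) :: 'n cmat"
  have lin: "Vector_Spaces.linear cscale cscale ?E"
    by unfold_locales
      (simp_all add: cscale_def vec_eq_iff mat_def trace_def algebra_simps sum.distrib
        sum_distrib_left add_divide_distrib)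
  have fix1: "?E (mat c) = mat c" for c by (simp add: trace_def mat_def)
  have bim: "?E (A ** X ** B) = A ** ?E X ** B" if A: "A \<in> scalars" "B \<in> scalars" for A B X
  proof -
    obtain a b where "A = mat a" "B = mat b" using A by (auto simp: scalars_def)
    then show ?thesis
      by (simp add: mat_mult trace_cscale) (simp add: cscale_def mat_def vec_eq_iff)
  qed
  have pos: "positive (?E X)" if X: "positive X" for X
  proof -
    obtain Y where Y: "X = adjm Y ** Y" using X by (auto simp: positive_def)
    define r where "r = (\<Sum>i\<in>UNIV. \<Sum>j\<in>UNIV. (cmod (Y $ j $ i))\<^sup>2) / CARD('n)"
    have "r \<ge> 0" by (simp add: r_def sum_nonneg)
    have "trace X / of_nat CARD('n) = of_real r"
      unfolding Y r_def trace_adjm_mult of_real_sum of_real_divide complex_norm_square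
      by (simp add: mult.commute)
    also have "\<dots> = of_real (sqrt r) * of_real (sqrt r)"
      using \<open>r \<ge> 0\<close> by (simp flip: of_real_mult)
    finally have "?E X = adjm (mat (of_real (sqrt r))) ** mat (of_real (sqrt r))"
      by (simp add: mat_mult) (simp add: cscale_def mat_def vec_eq_iff)
    then show ?thesis unfolding positive_def by blast
  qed
  have "conditional_expectation scalars ?E"
    unfolding conditional_expectation_def
    using lin fix1 bim pos by (auto simp: scalars_def)
  moreover have "trace (?E X) = trace X" for X by (simp add: trace_def mat_def)
  ultimately show ?thesis
    unfolding e1_def by (intro jones_projection_eqI unital_cstar_subalgebra_scalars)
qed

definition mat_unit :: "'n::finite \<Rightarrow> 'n \<Rightarrow> 'n cmat" where
  "mat_unit i j = (\<chi> k l. if k = i \<and> l = j then 1 else 0)"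

lemma cscale_vector_space: "vector_space (cscale :: complex \<Rightarrow> ('n::finite) cmat \<Rightarrow> _)"
  by unfold_locales (simp_all add: cscale_def vec_eq_iff algebra_simps)

lemma operators_iff:
  "T \<in> operators \<longleftrightarrow> (\<forall>X Y. T (X + Y) = T X + T Y) \<and> (\<forall>c X. T (cscale c X) = cscale c (T X))"
  unfolding operators_def Vector_Spaces.linear_iff using cscale_vector_space by auto

lemma operators_sum: "T \<in> operators \<Longrightarrow> T (\<Sum>a\<in>A. f a) = (\<Sum>a\<in>A. T (f a))"
proof (induction A rule: infinite_finite_induct)
  case empty
  then have "T (0 + 0) = T 0 + T 0" unfolding operators_iff by blast
  then show ?case by simp
next
  case (infinite A)
  then have "T (0 + 0) = T 0 + T 0" unfolding operators_iff by blast
  then show ?case using infinite by simp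
qed (auto simp: operators_iff)

lemma trace_mult_mat_unit: "trace (Y ** mat_unit i j) = Y $ j $ i"
  by (simp add: trace_def matrix_matrix_mult_def mat_unit_def if_distrib[of "\<lambda>x. _ * x"]
      if_if_eq_conj[symmetric] sum.delta cong: if_cong)

lemma trace_mat_unit_mult: "trace (mat_unit j i ** Y) = Y $ i $ j"
  using trace_mult_mat_unit[of Y j i] by (metis trace_mul_sym)

lemma dual_expectation_eq:
  fixes S :: "('n::finite) cmat \<Rightarrow> 'n cmat"
  assumes "S \<in> operators"
  shows "dual_expectation S = (\<chi> p i. (\<Sum>j\<in>UNIV. S (mat_unit i j) $ p $ j) / of_nat CARD('n))"
proof -
  let ?n = "of_nat CARD('n) :: complex"
  define G :: "('n cmat \<Rightarrow> 'n cmat) \<Rightarrow> 'n cmat" where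
    "G = restrict (\<lambda>S. \<chi> p i. (\<Sum>j\<in>UNIV. S (mat_unit i j) $ p $ j) / ?n) operators"
  define P :: "(('n cmat \<Rightarrow> 'n cmat) \<Rightarrow> 'n cmat) \<Rightarrow> bool" where
    "P F \<longleftrightarrow> F \<in> extensional operators \<and>
        (\<forall>S\<in>operators. \<forall>T\<in>operators. F (\<lambda>X. S X + T X) = F S + F T) \<and>
        (\<forall>c. \<forall>S\<in>operators. F (\<lambda>X. cscale c (S X)) = cscale c (F S)) \<and>
        (\<forall>x y. F (\<lambda>X. x ** e1 (y ** X)) = cscale (1 / ?n\<^sup>2) (x ** y))" for F
  have add: "(\<lambda>X. S X + T X) \<in> operators" if "S \<in> operators" "T \<in> operators"
    for S T :: "'n cmat \<Rightarrow> 'n cmat"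
    using that unfolding operators_iff by (auto simp: cscale_def vec_eq_iff algebra_simps)
  have scl: "(\<lambda>X. cscale c (S X)) \<in> operators" if "S \<in> operators"
    for S :: "'n cmat \<Rightarrow> 'n cmat" and c
    using that unfolding operators_iff by (auto simp: cscale_def vec_eq_iff algebra_simps)
  have rk: "x ** e1 (y ** X) = cscale (trace (y ** X) / ?n) x" for x y X :: "'n cmat"
    by (simp add: e1_eq mat_mult)
  have rk_op: "(\<lambda>X. x ** e1 (y ** X)) \<in> operators" for x y :: "'n cmat"
    unfolding operators_iff rk
    by (auto simp: cscale_def vec_eq_iff trace_def matrix_matrix_mult_def algebra_simps
        sum.distrib sum_distrib_left sum_divide_distrib add_divide_distrib)
  have G: "P G"
    unfolding P_def
  proof (intro conjI ballI allI)
    show "G \<in> extensional operators" by (simp add: G_def)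
  next
    fix S T :: "'n cmat \<Rightarrow> 'n cmat" assume "S \<in> operators" "T \<in> operators"
    then show "G (\<lambda>X. S X + T X) = G S + G T"
      by (simp add: G_def add) (simp add: vec_eq_iff sum.distrib add_divide_distrib)
  next
    fix S :: "'n cmat \<Rightarrow> 'n cmat" and c assume "S \<in> operators"
    then show "G (\<lambda>X. cscale c (S X)) = cscale c (G S)"
      by (simp add: G_def scl) (simp add: vec_eq_iff cscale_def sum_distrib_left)
  next
    fix x y :: "'n cmat"
    have "G (\<lambda>X. x ** e1 (y ** X)) =
        (\<chi> p i. (\<Sum>j\<in>UNIV. (x ** e1 (y ** mat_unit i j)) $ p $ j) / ?n)"
      using rk_op by (simp add: G_def)
    also have "\<dots> = cscale (1 / ?n\<^sup>2) (x ** y)"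
      unfolding rk trace_mult_mat_unit
      by (simp add: vec_eq_iff cscale_def matrix_matrix_mult_def sum_divide_distrib
          power2_eq_square mult.commute)
    finally show "G (\<lambda>X. x ** e1 (y ** X)) = cscale (1 / ?n\<^sup>2) (x ** y)" .
  qed
  have uniq: "F = G" if F: "P F" for F
  proof (rule extensionalityI[of F operators G])
    show "F \<in> extensional operators" "G \<in> extensional operators"
      using F G by (auto simp: P_def)
    fix T :: "'n cmat \<Rightarrow> 'n cmat" assume T: "T \<in> operators"
    have exp: "X = (\<Sum>(i,j)\<in>UNIV. cscale (X $ i $ j) (mat_unit i j))" for X :: "'n cmat"
    proof -
      have "(\<Sum>(i,j)\<in>UNIV. cscale (X $ i $ j) (mat_unit i j)) $ k $ l = X $ k $ l" for k l
      proof -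
        have "(\<Sum>(i,j)\<in>UNIV. cscale (X $ i $ j) (mat_unit i j)) $ k $ l =
            (\<Sum>a\<in>UNIV. if a = (k,l) then X $ k $ l else 0)"
          unfolding sum_component by (intro sum.cong) (auto simp: cscale_def mat_unit_def split: if_splits)
        then show ?thesis by simp
      qed
      then show ?thesis by (simp add: vec_eq_iff)
    qed
    have TX: "T = (\<lambda>X. \<Sum>(i,j)\<in>UNIV. cscale ?n (T (mat_unit i j) ** e1 (mat_unit j i ** X)))"
    proof
      fix X
      have "T X = (\<Sum>(i,j)\<in>UNIV. T (cscale (X $ i $ j) (mat_unit i j)))"
        by (subst exp[of X]) (simp add: operators_sum[OF T] case_prod_unfold)
      also have "\<dots> = (\<Sum>(i,j)\<in>UNIV. cscale ?n (T (mat_unit i j) ** e1 (mat_unit j i ** X)))"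
        using T unfolding rk trace_mat_unit_mult operators_iff
        by (intro sum.cong) (auto simp: cscale_def)
      finally show "T X = \<dots>" .
    qed
    have zero: "(\<lambda>X. 0) \<in> (operators :: ('n cmat \<Rightarrow> 'n cmat) set)"
      by (auto simp: operators_iff cscale_def vec_eq_iff)
    have sumF: "(\<lambda>X. \<Sum>a\<in>A. h a X) \<in> operators \<and> F (\<lambda>X. \<Sum>a\<in>A. h a X) = (\<Sum>a\<in>A. F (h a))"
      if F: "P F" and h: "\<And>a. h a \<in> operators" and "finite A"
      for A and h :: "'n \<times> 'n \<Rightarrow> 'n cmat \<Rightarrow> 'n cmat" and F
    proof -
      have Fadd: "F (\<lambda>X. S X + T X) = F S + F T" if "S \<in> operators" "T \<in> operators" for S T
        using F that unfolding P_def by blast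
      show ?thesis using \<open>finite A\<close>
      proof induction
        case empty
        have "F (\<lambda>X. 0 + 0) = F (\<lambda>X. 0) + F (\<lambda>X. 0)"
          by (rule Fadd[OF zero zero])
        then show ?case using zero by simp
      next
        case (insert a A)
        have "F (\<lambda>X. h a X + (\<Sum>a\<in>A. h a X)) = F (h a) + F (\<lambda>X. \<Sum>a\<in>A. h a X)"
          by (rule Fadd) (use h insert in auto)
        then show ?case using insert add[OF h[of a]] by simp
      qed
    qed
    let ?h = "\<lambda>(i,j) X. cscale ?n (T (mat_unit i j) ** e1 (mat_unit j i ** X))"
    have h: "?h a \<in> operators" for a
      by (cases a) (use rk_op scl in auto)
    have val: "K T = (\<Sum>(i,j)\<in>UNIV. cscale ?n (cscale (1 / ?n\<^sup>2) (T (mat_unit i j) ** mat_unit j i)))"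
      if K: "P K" for K
    proof -
      have 1: "K (?h (i, j)) = cscale ?n (cscale (1 / ?n\<^sup>2) (T (mat_unit i j) ** mat_unit j i))"
        for i j
        using K rk_op unfolding P_def by simp
      have "T = (\<lambda>X. \<Sum>a\<in>UNIV. ?h a X)"
        by (subst TX) (simp add: case_prod_unfold)
      then have "K T = K (\<lambda>X. \<Sum>a\<in>UNIV. ?h a X)" by (rule arg_cong)
      also have "\<dots> = (\<Sum>a\<in>UNIV. K (?h a))" using sumF[OF K h, of UNIV] by simp
      also have "\<dots> = (\<Sum>(i,j)\<in>UNIV. cscale ?n (cscale (1 / ?n\<^sup>2) (T (mat_unit i j) ** mat_unit j i)))"
        proof (intro sum.cong refl)
        fix a :: "'n \<times> 'n"
        obtain i j where a: "a = (i, j)" by (cases a)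
        show "K (?h a) = (case a of (i,j) \<Rightarrow>
            cscale ?n (cscale (1 / ?n\<^sup>2) (T (mat_unit i j) ** mat_unit j i)))"
          unfolding a prod.case by (rule 1[unfolded prod.case])
      qed
      finally show ?thesis .
    qed
    show "F T = G T" unfolding val[OF F] val[OF G] by (rule refl)
  qed
  have "dual_expectation = G"
    unfolding dual_expectation_def P_def[symmetric]
    by (rule the_equality) (rule G, rule uniq)
  then have "dual_expectation S = G S" by (rule fun_cong)
  also have "G S = (\<chi> p i. (\<Sum>j\<in>UNIV. S (mat_unit i j) $ p $ j) / ?n)"
    unfolding G_def by (rule restrict_apply'[OF assms])
  finally show ?thesis .
qed

end

(* Write e_C, e_D for the Jones projections of the diagonal algebra C and of D = u C u^*. The dual
   expectation turns (e_C - e_1)(e_D - e_1) = e_C e_D - e_1 into the matrix (N u^* - 1/n) / n with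
   N_{kl} = |u_{kl}|^2 u_{kl}, while both tilde norms square to (n - 1) / n^2. Let u be a rotation
   by (c, s) in a coordinate plane. On the coordinates that u fixes, N u^* - 1/n is the scalar
   1 - 1/n; since n >= 3 there is such a coordinate. On the rotated plane it is a real multiple of
   a rotation, of norm at most 1 - 1/n because 3 c^2 s^2 >= 4 c^2 s^2 / n. So the cosine is 1. *)

theory Submission
  imports Defs
begin

section \<open>Trace-preserving conditional expectations\<close>

text \<open>The bimodule property with right factor \<open>mat 1\<close> moves \<open>A\<close>
  inside \<open>E\<close>, and then \<open>E\<close> preserves the trace of
  \<open>A ** X\<close>.\<close>

lemma trace_mult_conditional_expectation:
  assumes "unital_cstar_subalgebra C" "conditional_expectation C E" "\<And>X. trace (E X) = trace X"
    and "A \<in> C"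
  shows "trace (A ** E X) = trace (A ** X)"
proof -
  have "E (A ** X ** mat 1) = A ** E X ** mat 1"
    using assms unfolding conditional_expectation_def unital_cstar_subalgebra_def by blast
  then show ?thesis using assms(3)[of "A ** X"] by simp
qed

section \<open>The trace inner product, adjoints and differences of projections\<close>

lemma tau_inner_commute: "tau_inner Y X = cnj (tau_inner X Y)"
  by (simp add: tau_inner_def trace_adjm_mult mult.commute)

lemma tau_inner_diff_left: "tau_inner (X - Y) Z = tau_inner X Z - tau_inner Y Z"
  by (simp add: tau_inner_def trace_adjm_mult algebra_simps sum_subtractf diff_divide_distrib)

lemma tau_inner_diff_right: "tau_inner Z (X - Y) = tau_inner Z X - tau_inner Z Y"
  by (simp add: tau_inner_def trace_adjm_mult algebra_simps sum_subtractf diff_divide_distrib)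

lemma tau_inner_self_eq_0: "tau_inner X X = 0 \<Longrightarrow> X = 0"
  by (auto simp: tau_inner_def intro: trace_adjm_self_eq_0)

text \<open>The inner product is definite, so at most one map can satisfy the adjoint equation; this
  evaluates the definite description in \<open>op_adjoint\<close>.\<close>

lemma op_adjoint_eqI:
  assumes "\<And>X Y. tau_inner (S X) Y = tau_inner X (S' Y)"
  shows "op_adjoint S = S'"
  unfolding op_adjoint_def
proof (rule the_equality)
  show "\<forall>X Y. tau_inner (S X) Y = tau_inner X (S' Y)" using assms by blast
next
  fix R assume R: "\<forall>X Y. tau_inner (S X) Y = tau_inner X (R Y)"
  show "R = S'"
  proof
    fix Y
    \<comment> \<open>Both candidates pair identically with every left argument; their own
      difference is chosen as that argument.\<close>
    have "tau_inner (R Y - S' Y) (R Y - S' Y) = 0"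
      using R assms[of "R Y - S' Y" Y] by (simp add: tau_inner_diff_right)
    then show "R Y = S' Y" using tau_inner_self_eq_0 by fastforce
  qed
qed

text \<open>A trace-preserving conditional expectation is self-adjoint: both sides equal
  \<open>tau_inner (E X) (E Y)\<close>, the second by conjugate symmetry.\<close>

lemma tau_inner_conditional_expectation:
  assumes "unital_cstar_subalgebra C" "conditional_expectation C E" "\<And>X. trace (E X) = trace X"
  shows "tau_inner (E X) Y = tau_inner X (E Y)"
proof -
  have *: "tau_inner (E X) Y = tau_inner (E X) (E Y)" for X Y
  proof -
    have "adjm (E X) \<in> C"
      using assms unfolding conditional_expectation_def unital_cstar_subalgebra_def by blast
    then show ?thesis
      using trace_mult_conditional_expectation[OF assms] by (simp add: tau_inner_def)
  qed
  then show ?thesis by (metis tau_inner_commute)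
qed

lemma tau_inner_e1: "tau_inner (e1 X) Y = tau_inner X (e1 Y)"
  by (simp add: tau_inner_def e1_eq mat_mult trace_cscale) (simp add: trace_def adjm_def)

lemma conditional_expectation_mat:
  assumes "unital_cstar_subalgebra C" "conditional_expectation C E"
  shows "E (mat c) = mat c"
proof -
  have "cscale c (mat 1) \<in> C"
    using assms by (auto simp: unital_cstar_subalgebra_def)
  moreover have "cscale c (mat 1) = mat c" by (simp add: cscale_def mat_def vec_eq_iff)
  ultimately show ?thesis using assms by (metis conditional_expectation_def)
qed

text \<open>Both differences are self-adjoint, and (E - e1)(F - e1) = EF - e1 because E fixes
  scalars and F preserves the trace. The dual expectation, a normalised partial trace, is then read
  off on matrix units.\<close>

lemma op_inner_diff_e1:
  fixes E F :: "('n::finite) cmat \<Rightarrow> 'n cmat"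
  assumes C: "unital_cstar_subalgebra C" "conditional_expectation C E" "\<And>X. trace (E X) = trace X"
    and D: "unital_cstar_subalgebra D" "conditional_expectation D F" "\<And>X. trace (F X) = trace X"
  shows "op_inner (\<lambda>X. E X - e1 X) (\<lambda>X. F X - e1 X) =
    (\<chi> p i. ((\<Sum>j\<in>UNIV. E (F (mat_unit i j)) $ p $ j)
       - (if p = i then 1 / of_nat CARD('n) else 0)) / of_nat CARD('n))"
proof -
  have lin: "E \<in> operators" "F \<in> operators"
    using C D by (auto simp: conditional_expectation_def operators_def)
  have Ediff: "E (X - Y) = E X - E Y" for X Y
    using lin(1) unfolding operators_iff by (metis add_diff_cancel_right' diff_add_cancel)
  have adj: "op_adjoint (\<lambda>X. E X - e1 X) = (\<lambda>X. E X - e1 X)"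
    by (rule op_adjoint_eqI)
      (simp add: tau_inner_diff_left tau_inner_diff_right tau_inner_e1
        tau_inner_conditional_expectation[OF C])
  have "trace (mat c :: 'n cmat) = of_nat CARD('n) * c" for c
    by (simp add: trace_def mat_def)
  then have comp: "(\<lambda>X. E X - e1 X) \<circ> (\<lambda>X. F X - e1 X) = (\<lambda>X. E (F X) - e1 X)"
    by (simp add: fun_eq_iff Ediff e1_eq conditional_expectation_mat[OF C(1,2)] trace_sub D(3))
  have "(\<lambda>X. E (F X) - e1 X) \<in> operators"
  proof -
    have "e1 (X + Y) = e1 X + (e1 Y :: 'n cmat)" "e1 (cscale c X) = (cscale c (e1 X) :: 'n cmat)"
      for X Y c
      by (simp_all add: e1_eq trace_add trace_cscale)
        (simp_all add: cscale_def mat_def vec_eq_iff add_divide_distrib)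
    moreover have "cscale c (X - Y) = cscale c X - (cscale c Y :: 'n cmat)" for c X Y
      by (simp add: cscale_def vec_eq_iff right_diff_distrib)
    ultimately show ?thesis using lin by (simp add: operators_iff)
  qed
  note dual_expectation_eq[OF this]
  moreover have tr: "trace (mat_unit i j :: 'n cmat) = (if i = j then 1 else 0)" for i j
    by (auto simp: trace_def mat_unit_def if_if_eq_conj[symmetric] intro!: sum.neutral cong: if_cong)
  have "(\<Sum>j\<in>UNIV. (E (F (mat_unit i j)) - e1 (mat_unit i j)) $ p $ j) =
    (\<Sum>j\<in>UNIV. E (F (mat_unit i j)) $ p $ j) - (if p = i then 1 / of_nat CARD('n) else 0)" for p i
  proof -
    \<comment> \<open>\<open>e1\<close> sends \<open>mat_unit i j\<close> to the scalar 1/n if i = j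
      and to 0 otherwise; a scalar has a nonzero entry at (p, j) only for j = p, so only i = j = p
      contributes.\<close>
    have "(\<Sum>j\<in>UNIV. e1 (mat_unit i j) $ p $ j)
        = (\<Sum>j\<in>UNIV. if j = p then (if p = i then 1 / of_nat CARD('n) else 0) else 0)"
      by (intro sum.cong) (auto simp: e1_eq tr mat_def)
    then show ?thesis by (simp add: sum_subtractf)
  qed
  ultimately show ?thesis
    by (simp add: op_inner_def adj comp)
qed

section \<open>The diagonal algebra and its conjugates\<close>

definition diag_part :: "('n::finite) cmat \<Rightarrow> 'n cmat" where
  "diag_part X = (\<chi> p q. if p = q then X $ p $ q else 0)"

lemma diagonals_mult_nth:
  assumes "A \<in> diagonals"
  shows "(A ** X) $ p $ q = A $ p $ p * X $ p $ q" "(X ** A) $ p $ q = X $ p $ q * A $ q $ q"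
proof -
  have "(\<Sum>k\<in>UNIV. A $ p $ k * X $ k $ q) = (\<Sum>k\<in>{p}. A $ p $ k * X $ k $ q)"
    "(\<Sum>k\<in>UNIV. X $ p $ k * A $ k $ q) = (\<Sum>k\<in>{q}. X $ p $ k * A $ k $ q)"
    using assms by (intro sum.mono_neutral_right; auto simp: diagonals_def)+
  then show "(A ** X) $ p $ q = A $ p $ p * X $ p $ q" "(X ** A) $ p $ q = X $ p $ q * A $ q $ q"
    by (simp_all add: matrix_matrix_mult_def)
qed

text \<open>The diagonal entries of Y* Y are the squared norms \<open>d p\<close> of the columns of
  Y, so the diagonal matrix of their square roots is a witness of positivity.\<close>

lemma positive_diag_part:
  assumes "positive X" shows "positive (diag_part X)"
proof -
  obtain Y where Y: "X = adjm Y ** Y" using assms by (auto simp: positive_def)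
  define d where "d p = (\<Sum>k\<in>UNIV. (cmod (Y $ k $ p))\<^sup>2)" for p
  define Z where "Z = (\<chi> p q. if p = q then complex_of_real (sqrt (d p)) else 0)"
  have Z: "Z \<in> diagonals" by (simp add: Z_def diagonals_def)
  have d: "X $ p $ p = complex_of_real (d p)" for p
    unfolding Y d_def of_real_sum complex_norm_square
    by (simp add: adjm_def matrix_matrix_mult_def mult.commute)
  have "d p \<ge> 0" for p by (simp add: d_def sum_nonneg)
  then have "complex_of_real (sqrt (d p)) * complex_of_real (sqrt (d p)) = complex_of_real (d p)" for p
    by (simp flip: of_real_mult)
  then have "diag_part X = adjm Z ** Z"
    by (simp add: vec_eq_iff diagonals_mult_nth[OF Z] diag_part_def d)
      (auto simp: adjm_def Z_def)
  then show ?thesis by (auto simp: positive_def)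
qed

lemma conditional_expectation_diag_part: "conditional_expectation diagonals diag_part"
proof -
  have "diag_part \<in> operators"
    unfolding operators_iff by (simp add: diag_part_def cscale_def vec_eq_iff)
  moreover have "diag_part (A ** X ** B) = A ** diag_part X ** B"
    if "A \<in> diagonals" "B \<in> diagonals" for A X B :: "'a cmat"
    using that by (simp add: vec_eq_iff diagonals_mult_nth diag_part_def)
  ultimately show ?thesis
    unfolding conditional_expectation_def operators_def
    by (simp add: positive_diag_part image_subset_iff)
      (simp add: diag_part_def diagonals_def vec_eq_iff)
qed

lemma trace_diag_part: "trace (diag_part X) = trace X"
  by (simp add: trace_def diag_part_def)

section \<open>Transport of conditional expectations along a unitary\<close>

definition conj_map :: "('n::finite) cmat \<Rightarrow> ('n cmat \<Rightarrow> 'n cmat) \<Rightarrow> 'n cmat \<Rightarrow> 'n cmat" where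
  "conj_map u E X = u ** E (adjm u ** X ** u) ** adjm u"

lemma unitary_cancel:
  assumes "unitary u"
  shows "adjm u ** (u ** X) = X" "u ** (adjm u ** X) = X"
  using assms by (simp_all add: unitary_def matrix_mul_assoc)

lemma positive_conj:
  assumes "positive X" shows "positive (A ** X ** adjm A)"
proof -
  obtain Y where "X = adjm Y ** Y" using assms by (auto simp: positive_def)
  then have "A ** X ** adjm A = adjm (Y ** adjm A) ** (Y ** adjm A)"
    by (simp add: adjm_mult matrix_mul_assoc)
  then show ?thesis by (auto simp: positive_def)
qed

lemma cscale_mult: "cscale c X ** Y = cscale c (X ** Y)" "X ** cscale c Y = cscale c (X ** Y)"
  by (metis mat_mult matrix_mul_assoc)+

text \<open>Conjugation by \<open>u\<close> is a *-automorphism carrying \<open>C\<close> onto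
  \<open>conj_alg u C\<close>, so each defining property is carried over after cancelling adjacent
  factors \<open>u\<close> and \<open>adjm u\<close>.\<close>

lemma conditional_expectation_conj_map:
  assumes u: "unitary u" and E: "conditional_expectation C E"
  shows "conditional_expectation (conj_alg u C) (conj_map u E)"
proof -
  have lin: "E (X + Y) = E X + E Y" "E (cscale c X) = cscale c (E X)" for X Y c
    using E operators_iff[of E] by (auto simp: conditional_expectation_def operators_def)
  have E': "\<And>X. E X \<in> C" "\<And>X. X \<in> C \<Longrightarrow> E X = X" "\<And>X. positive X \<Longrightarrow> positive (E X)"
    "\<And>A B X. A \<in> C \<Longrightarrow> B \<in> C \<Longrightarrow> E (A ** X ** B) = A ** E X ** B"
    using E by (auto simp: conditional_expectation_def)
  note cancel = unitary_cancel[OF u] u[unfolded unitary_def]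
  have "conj_map u E \<in> operators"
    by (simp add: operators_iff conj_map_def mat_mult_add_sub cscale_mult lin)
  moreover have "conj_map u E X \<in> conj_alg u C" for X
    using E' by (auto simp: conj_map_def conj_alg_def)
  moreover have "conj_map u E X = X" if "X \<in> conj_alg u C" for X
    using that E' by (auto simp: conj_map_def conj_alg_def matrix_mul_assoc[symmetric] cancel)
  moreover have "conj_map u E (A ** X ** B) = A ** conj_map u E X ** B"
    if AB: "A \<in> conj_alg u C" "B \<in> conj_alg u C" for A B X
  proof -
    obtain a b where ab: "a \<in> C" "b \<in> C" "A = u ** a ** adjm u" "B = u ** b ** adjm u"
      using AB by (auto simp: conj_alg_def)
    have "adjm u ** (A ** X ** B) ** u = a ** (adjm u ** X ** u) ** b"
      by (simp add: ab matrix_mul_assoc[symmetric] cancel)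
    then have "conj_map u E (A ** X ** B) = u ** (a ** E (adjm u ** X ** u) ** b) ** adjm u"
      by (simp add: conj_map_def E' ab)
    also have "\<dots> = A ** conj_map u E X ** B"
      by (simp add: ab conj_map_def matrix_mul_assoc[symmetric] cancel)
    finally show ?thesis .
  qed
  moreover have "positive (conj_map u E X)" if "positive X" for X
    using positive_conj[OF that, of "adjm u"] by (simp add: conj_map_def positive_conj E')
  ultimately show ?thesis
    unfolding conditional_expectation_def operators_def by auto
qed

lemma trace_conj_map:
  assumes u: "unitary u" and E: "\<And>X. trace (E X) = trace X"
  shows "trace (conj_map u E X) = trace X"
proof -
  have "trace (conj_map u E X) = trace (E (adjm u ** X ** u))"
    unfolding conj_map_def
    \<comment> \<open>Cyclicity brings the trailing \<open>adjm u\<close> next to the leading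
      \<open>u\<close>, where the two cancel.\<close>
    by (subst trace_mul_sym) (simp add: unitary_cancel[OF u] matrix_mul_assoc[symmetric])
  also have "\<dots> = trace X"
    unfolding E by (subst trace_mul_sym) (simp add: unitary_cancel[OF u])
  finally show ?thesis .
qed

text \<open>Only the diagonal of u* e_ij u survives \<open>diag_part\<close>; its l-th entry is
  \<open>cnj (u $ i $ l) * u $ j $ l\<close>, and conjugating back contributes the other two
  factors.\<close>

lemma conj_map_diag_part_mat_unit:
  "conj_map u diag_part (mat_unit i j) $ p $ q =
     (\<Sum>l\<in>UNIV. u $ p $ l * cnj (u $ q $ l) * cnj (u $ i $ l) * u $ j $ l)"
proof -
  have 1: "(mat_unit i j ** u) $ a $ b = (if a = i then u $ j $ b else 0)" for a b
    by (simp add: matrix_matrix_mult_def mat_unit_def if_distrib[of "\<lambda>x. x * _"]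
        if_if_eq_conj[symmetric] cong: if_cong)
  have 2: "(adjm u ** mat_unit i j ** u) $ l $ l = cnj (u $ i $ l) * u $ j $ l" for l
  proof -
    have "(adjm u ** (mat_unit i j ** u)) $ l $ l = (\<Sum>k\<in>UNIV. adjm u $ l $ k * (mat_unit i j ** u) $ k $ l)"
      by (subst matrix_matrix_mult_def) simp
    then show ?thesis
      by (simp add: 1 adjm_def matrix_mul_assoc if_distrib[of "\<lambda>x. _ * x"] cong: if_cong)
  qed
  have D: "diag_part Y \<in> diagonals" for Y :: "'a cmat" by (simp add: diag_part_def diagonals_def)
  let ?Y = "adjm u ** mat_unit i j ** u"
  have "conj_map u diag_part (mat_unit i j) $ p $ q
      = (\<Sum>l\<in>UNIV. (u ** diag_part ?Y) $ p $ l * adjm u $ l $ q)"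
    unfolding conj_map_def by (subst matrix_matrix_mult_def) simp
  also have "\<dots> = (\<Sum>l\<in>UNIV. u $ p $ l * ?Y $ l $ l * adjm u $ l $ q)"
    by (simp only: diagonals_mult_nth[OF D]) (simp add: diag_part_def)
  finally show ?thesis unfolding 2 by (simp add: adjm_def mult_ac)
qed

section \<open>Jones projections of the diagonal algebras and their inner products\<close>

lemma jones_projection_conj_diagonals:
  assumes "unitary u"
  shows "jones_projection (conj_alg u diagonals) = conj_map u diag_part"
  by (rule jones_projection_eqI)
    (use assms in \<open>simp_all add: unital_cstar_subalgebra_conj_alg unital_cstar_subalgebra_diagonals
      conditional_expectation_conj_map conditional_expectation_diag_part trace_conj_map
      trace_diag_part\<close>)

lemma jones_projection_diagonals: "jones_projection diagonals = diag_part"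
  by (rule jones_projection_eqI)
    (simp_all add: unital_cstar_subalgebra_diagonals conditional_expectation_diag_part
      trace_diag_part)

lemma conj_map_idem:
  assumes "unitary u" "conditional_expectation C E"
  shows "conj_map u E (conj_map u E X) = conj_map u E X"
proof -
  have "conditional_expectation (conj_alg u C) (conj_map u E)"
    using assms by (rule conditional_expectation_conj_map)
  then show ?thesis unfolding conditional_expectation_def by blast
qed

lemma unitary_rows:
  assumes "unitary u"
  shows "(\<Sum>l\<in>UNIV. u $ p $ l * cnj (u $ q $ l)) = (if p = q then 1 else 0)"
proof -
  have "(u ** adjm u) $ p $ q = mat 1 $ p $ q" using assms by (simp add: unitary_def)
  then show ?thesis by (simp add: matrix_matrix_mult_def adjm_def mat_def)
qed

lemma unitary_columns:
  assumes "unitary u"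
  shows "(\<Sum>l\<in>UNIV. u $ l $ p * cnj (u $ l $ q)) = (if p = q then 1 else 0)"
proof -
  have "(adjm u ** u) $ q $ p = mat 1 $ q $ p" using assms by (simp add: unitary_def)
  then show ?thesis by (simp add: matrix_matrix_mult_def adjm_def mat_def mult.commute eq_commute)
qed

text \<open>Idempotence reduces the product to a single projection. Summing over j uses orthonormal
  columns and summing over l orthonormal rows, which leaves a scalar matrix. Taking
  \<open>u = mat 1\<close> covers the diagonal algebra itself.\<close>

lemma op_inner_conj_diagonals_self:
  fixes u :: "('n::finite) cmat"
  assumes u: "unitary u"
  defines "S \<equiv> \<lambda>X. conj_map u diag_part X - e1 X"
  shows "op_inner S S = mat (of_real ((real CARD('n) - 1) / (real CARD('n))\<^sup>2))"
proof -
  note c = conditional_expectation_diag_part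
  have "op_inner S S = (\<chi> p i. ((\<Sum>j\<in>UNIV. conj_map u diag_part (mat_unit i j) $ p $ j)
       - (if p = i then 1 / of_nat CARD('n) else 0)) / of_nat CARD('n))"
    unfolding S_def
    by (subst op_inner_diff_e1[of "conj_alg u diagonals" _ "conj_alg u diagonals"])
      (simp_all add: u unital_cstar_subalgebra_conj_alg unital_cstar_subalgebra_diagonals
        conditional_expectation_conj_map c trace_conj_map trace_diag_part conj_map_idem[OF u c])
  moreover have "(\<Sum>j\<in>UNIV. conj_map u diag_part (mat_unit i j) $ p $ j) = (if p = i then 1 else 0)"
    for p i
  proof -
    have "(\<Sum>j\<in>UNIV. conj_map u diag_part (mat_unit i j) $ p $ j) =
      (\<Sum>l\<in>UNIV. \<Sum>j\<in>UNIV. u $ p $ l * cnj (u $ i $ l) * (u $ j $ l * cnj (u $ j $ l)))"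
      \<comment> \<open>The exchange makes the sum over j innermost, where it is the squared norm of
        column l and equals 1.\<close>
      unfolding conj_map_diag_part_mat_unit by (subst sum.swap) (simp add: mult_ac)
    also have "\<dots> = (\<Sum>l\<in>UNIV. u $ p $ l * cnj (u $ i $ l))"
      by (simp flip: sum_distrib_left add: unitary_columns[OF u])
    finally show ?thesis by (simp add: unitary_rows[OF u])
  qed
  moreover have "(1 - 1 / of_nat CARD('n)) / of_nat CARD('n)
      = complex_of_real ((real CARD('n) - 1) / (real CARD('n))\<^sup>2)"
    by (simp add: power2_eq_square field_simps)
  ultimately show ?thesis
    by (simp add: vec_eq_iff mat_def)
qed

lemma conj_map_mat_1: "conj_map (mat 1) E = E"
  by (simp add: conj_map_def fun_eq_iff)

lemma unitary_mat_1: "unitary (mat 1)"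
  by (simp add: unitary_def)

text \<open>The outer \<open>diag_part\<close> keeps only the term j = p of the partial trace; this
  is how the cubic expression in the entries of row p arises.\<close>

lemma op_inner_diagonals_conj_diagonals:
  fixes u :: "('n::finite) cmat"
  assumes u: "unitary u"
  shows "op_inner (\<lambda>X. diag_part X - e1 X) (\<lambda>X. conj_map u diag_part X - e1 X) =
    (\<chi> p i. ((\<Sum>l\<in>UNIV. u $ p $ l * cnj (u $ p $ l) * u $ p $ l * cnj (u $ i $ l))
       - (if p = i then 1 / of_nat CARD('n) else 0)) / of_nat CARD('n))"
proof -
  have "(\<Sum>j\<in>UNIV. diag_part (conj_map u diag_part (mat_unit i j)) $ p $ j) =
      (\<Sum>l\<in>UNIV. u $ p $ l * cnj (u $ p $ l) * u $ p $ l * cnj (u $ i $ l))" for p i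
    by (simp add: diag_part_def conj_map_diag_part_mat_unit mult_ac)
  then show ?thesis
    by (subst op_inner_diff_e1[of diagonals _ "conj_alg u diagonals"])
      (simp_all add: u unital_cstar_subalgebra_conj_alg unital_cstar_subalgebra_diagonals
        conditional_expectation_conj_map conditional_expectation_diag_part trace_conj_map
        trace_diag_part)
qed

section \<open>Operator norms and the criterion for a vanishing angle\<close>

lemma op_norm_eqI:
  assumes "\<And>v. norm (X *v v) \<le> r * norm v" "norm (X *v w) = r * norm w" "w \<noteq> 0"
  shows "op_norm X = r"
proof (rule antisym)
  show "op_norm X \<le> r" unfolding op_norm_def by (rule onorm_le) (rule assms)
  have "norm (X *v w) \<le> op_norm X * norm w"
    unfolding op_norm_def by (rule onorm) simp
  then show "r \<le> op_norm X" using assms by simp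
qed

lemma norm_mult_complex_vec:
  fixes v :: "complex^'n::finite"
  shows "norm (\<chi> i. c * v $ i) = cmod c * norm v"
  by (simp add: norm_vec_def L2_set_def norm_mult power_mult_distrib sum_distrib_left[symmetric]
      real_sqrt_mult)

lemma op_norm_mat: "op_norm (mat c :: ('n::finite) cmat) = cmod c"
proof -
  have "(mat c :: 'n cmat) *v v = (\<chi> i. c * v $ i)" for v
    by (simp add: vec_eq_iff matrix_vector_mult_def mat_def if_distrib[of "\<lambda>x. x * _"] cong: if_cong)
  then have "norm ((mat c :: 'n cmat) *v v) = cmod c * norm v" for v
    by (simp only: norm_mult_complex_vec)
  then show ?thesis
    \<comment> \<open>A scalar matrix stretches every vector by the same factor; the all-ones vector
      is merely a nonzero witness.\<close>
    by (intro op_norm_eqI[where w = "\<chi> i. 1"]) (simp_all add: vec_eq_iff)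
qed

text \<open>Both tilde norms are the square root of (n - 1) / n^2, so the hypothesis on the
  numerator says that the cosine is 1; n at least 2 keeps the denominator positive.\<close>

lemma interior_angle_eq_0I:
  fixes u :: "('n::finite) cmat"
  assumes u: "unitary u" and n: "CARD('n) \<ge> 2"
    and norm: "op_norm (op_inner (\<lambda>X. diag_part X - e1 X) (\<lambda>X. conj_map u diag_part X - e1 X)) =
      (real CARD('n) - 1) / (real CARD('n))\<^sup>2"
  shows "interior_angle diagonals (conj_alg u diagonals) = 0"
proof -
  let ?r = "(real CARD('n) - 1) / (real CARD('n))\<^sup>2"
  have r: "?r > 0" using n by simp
  have t: "tilde_norm (\<lambda>X. conj_map v diag_part X - e1 X) = sqrt ?r" if "unitary v" for v :: "'n cmat"
    unfolding tilde_norm_def op_inner_conj_diagonals_self[OF that] op_norm_mat norm_of_real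
    using r by (simp del: of_real_divide)
  have "interior_angle diagonals (conj_alg u diagonals) = (THE a. a \<in> {0..pi/2} \<and> cos a = 1)"
    unfolding interior_angle_def Let_def jones_projection_diagonals norm
      jones_projection_conj_diagonals[OF u] t[OF u] t[OF unitary_mat_1, unfolded conj_map_mat_1]
      real_sqrt_mult_self abs_of_pos[OF r] divide_self[OF less_imp_neq[OF r, symmetric]] ..
  also have "\<dots> = 0"
  proof (rule the_equality)
    fix a :: real assume a: "a \<in> {0..pi/2} \<and> cos a = 1"
    \<comment> \<open>This places \<open>a\<close> in [0, pi], where the cosine is
      injective.\<close>
    then have "a \<le> pi" using pi_gt_zero by (simp del: pi_gt_zero)
    then show "a = 0" using a cos_inj_pi[of a 0] by simp
  qed simp
  finally show ?thesis .
qed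

section \<open>Plane rotations\<close>

definition plane_rotation :: "'n::finite \<Rightarrow> 'n \<Rightarrow> real \<Rightarrow> real \<Rightarrow> 'n cmat" where
  "plane_rotation i j c s = (\<chi> p q.
     if p = i \<and> q = i \<or> p = j \<and> q = j then of_real c
     else if p = i \<and> q = j then of_real s
     else if p = j \<and> q = i then - of_real s
     else if p = q then 1 else 0)"

locale coordinate_plane =
  fixes i j :: "'n::finite" and c s :: real
  assumes ij: "i \<noteq> j" and cs: "c\<^sup>2 + s\<^sup>2 = 1"
begin

abbreviation "u \<equiv> plane_rotation i j c s"

text \<open>A row has at most two nonzero entries. The summand is an arbitrary function of entry and
  column vanishing at entry 0, so that one lemma evaluates the row products for unitarity as well as
  the cubic sums in \<open>gram\<close>.\<close>

lemma sum_row: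
  fixes f :: "complex \<Rightarrow> 'n \<Rightarrow> complex"
  assumes "\<And>l. f 0 l = 0"
  shows "(\<Sum>l\<in>UNIV. f (u $ p $ l) l) =
    (if p = i then f (of_real c) i + f (of_real s) j
     else if p = j then f (- of_real s) i + f (of_real c) j else f 1 p)"
proof -
  consider "p = i" | "p = j" | "p \<noteq> i" "p \<noteq> j" by blast
  then show ?thesis
  proof cases
    case 1
    have "(\<Sum>l\<in>UNIV. f (u $ p $ l) l) = (\<Sum>l\<in>{i, j}. f (u $ p $ l) l)"
      by (rule sum.mono_neutral_right) (auto simp: 1 plane_rotation_def assms ij)
    then show ?thesis using ij 1 by (simp add: plane_rotation_def)
  next
    case 2
    have "(\<Sum>l\<in>UNIV. f (u $ p $ l) l) = (\<Sum>l\<in>{i, j}. f (u $ p $ l) l)"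
      by (rule sum.mono_neutral_right) (auto simp: 2 plane_rotation_def assms ij)
    then show ?thesis using ij 2 by (simp add: plane_rotation_def)
  next
    case 3
    have "(\<Sum>l\<in>UNIV. f (u $ p $ l) l) = (\<Sum>l\<in>{p}. f (u $ p $ l) l)"
      by (rule sum.mono_neutral_right) (auto simp: 3 plane_rotation_def assms)
    then show ?thesis using 3 by (simp add: plane_rotation_def)
  qed
qed

lemma unitary_plane_rotation: "unitary u"
proof -
  have cs': "complex_of_real c * of_real c + of_real s * of_real s = 1"
    using arg_cong[OF cs, of complex_of_real] by (simp add: power2_eq_square)
  have "(u ** adjm u) $ p $ q = mat 1 $ p $ q" for p q
  proof -
    have "(u ** adjm u) $ p $ q = (\<Sum>l\<in>UNIV. u $ p $ l * cnj (u $ q $ l))"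
      by (simp add: matrix_matrix_mult_def adjm_def)
    also have "\<dots> = mat 1 $ p $ q"
      using ij cs' by (subst sum_row) (auto simp: plane_rotation_def mat_def add.commute)
    finally show ?thesis .
  qed
  then have "u ** adjm u = mat 1" by (simp add: vec_eq_iff)
  \<comment> \<open>For square matrices a right inverse is also a left inverse.\<close>
  then show ?thesis by (simp add: unitary_def matrix_left_right_inverse)
qed

text \<open>Conjugating the diagonal matrix unit at i produces the off-diagonal entry - c s at (i,
  j), which is nonzero.\<close>

lemma diagonals_ne_conj:
  assumes "c \<noteq> 0" "s \<noteq> 0"
  shows "diagonals \<noteq> conj_alg u diagonals"
proof
  let ?X = "u ** mat_unit i i ** adjm u"
  assume eq: "diagonals = conj_alg u diagonals"
  have D: "mat_unit i i \<in> diagonals" by (auto simp: mat_unit_def diagonals_def)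
  then have "?X \<in> diagonals" by (subst eq) (auto simp: conj_alg_def)
  then have "?X $ i $ j = 0" using ij by (simp add: diagonals_def)
  moreover have "?X $ i $ j = (\<Sum>l\<in>UNIV. u $ i $ l * (mat_unit i i $ l $ l * cnj (u $ j $ l)))"
    unfolding matrix_matrix_mult_def[of "u ** _"]
    by (simp add: diagonals_mult_nth[OF D] adjm_def mult_ac)
  moreover have "\<dots> = - (of_real c * of_real s)"
    using ij by (subst sum_row) (auto simp: plane_rotation_def mat_unit_def)
  ultimately show False using assms by simp
qed

section \<open>The matrix whose norm is the numerator of the cosine\<close>

definition gram :: "'n cmat" where
  "gram = op_inner (\<lambda>X. diag_part X - e1 X) (\<lambda>X. conj_map u diag_part X - e1 X)"

text \<open>On the plane of i and j, the rows (c^3, s^3) and (-s^3, c^3) of entrywise |u|^2 u are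
  multiplied by u*, giving c^4 + s^4 on the diagonal and -b, b off it. Each remaining coordinate is
  an eigendirection.\<close>

lemma gram_mult_vec:
  defines "a \<equiv> c ^ 4 + s ^ 4 - 1 / real CARD('n)" and "b \<equiv> c * s * (c\<^sup>2 - s\<^sup>2)"
  shows "(gram *v v) $ p = (if p = i then of_real a * v $ i - of_real b * v $ j
     else if p = j then of_real b * v $ i + of_real a * v $ j
     else of_real (1 - 1 / real CARD('n)) * v $ p) / of_nat CARD('n)"
proof -
  have entry: "gram $ p $ q = of_real (if p = q then (if p = i \<or> p = j then a else 1 - 1 / real CARD('n))
      else if p = i \<and> q = j then - b else if p = j \<and> q = i then b else 0) / of_nat CARD('n)" for p q
    unfolding gram_def op_inner_diagonals_conj_diagonals[OF unitary_plane_rotation] vec_lambda_beta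
    using ij
    by (subst sum_row) (auto simp: a_def b_def plane_rotation_def algebra_simps
        power2_eq_square power4_eq_xxxx)
  have mv: "(gram *v v) $ p = (\<Sum>q\<in>UNIV. gram $ p $ q * v $ q)"
    by (simp add: matrix_vector_mult_def)
  have restrict: "(gram *v v) $ p = (\<Sum>q\<in>K. gram $ p $ q * v $ q)"
    if "\<And>q. q \<notin> K \<Longrightarrow> gram $ p $ q = 0" for K
    unfolding mv by (rule sum.mono_neutral_right) (simp_all add: that)
  consider "p = i" | "p = j" | "p \<noteq> i" "p \<noteq> j" by blast
  then show ?thesis
  proof cases
    case 1
    have "(gram *v v) $ p = (\<Sum>q\<in>{i, j}. gram $ p $ q * v $ q)"
      by (rule restrict) (auto simp: entry 1)
    then show ?thesis
      using 1 ij by (simp add: entry diff_divide_distrib add_divide_distrib)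
  next
    case 2
    have "(gram *v v) $ p = (\<Sum>q\<in>{i, j}. gram $ p $ q * v $ q)"
      by (rule restrict) (auto simp: entry 2)
    then show ?thesis
      using 2 ij by (simp add: entry diff_divide_distrib add_divide_distrib)
  next
    case 3
    have "(gram *v v) $ p = (\<Sum>q\<in>{p}. gram $ p $ q * v $ q)"
      by (rule restrict) (auto simp: entry 3)
    then show ?thesis
      using 3 by (simp add: entry)
  qed
qed

text \<open>With x = c^2 s^2 and m = 1/n, the identities c^4 + s^4 = 1 - 2x and b^2 = x (1 - 4x)
  make the quadratic terms in x cancel, so the gap between the two sides is x (3 - 4m).\<close>

lemma rotation_scale_bound:
  defines "a \<equiv> c ^ 4 + s ^ 4 - 1 / real CARD('n)" and "b \<equiv> c * s * (c\<^sup>2 - s\<^sup>2)"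
  assumes "CARD('n) \<ge> 2"
  shows "a\<^sup>2 + b\<^sup>2 \<le> (1 - 1 / real CARD('n))\<^sup>2"
proof -
  define x where "x = c\<^sup>2 * s\<^sup>2"
  define m where "m = 1 / real CARD('n)"
  have s2: "s\<^sup>2 = 1 - c\<^sup>2" using cs by simp
  have p4: "c ^ 4 + s ^ 4 = 1 - 2 * x"
  proof -
    have "c ^ 4 + s ^ 4 = (c\<^sup>2)\<^sup>2 + (s\<^sup>2)\<^sup>2" by simp
    then show ?thesis unfolding x_def s2 by algebra
  qed
  have b2: "b\<^sup>2 = x * (1 - 4 * x)"
  proof -
    have "b\<^sup>2 = c\<^sup>2 * s\<^sup>2 * (c\<^sup>2 - s\<^sup>2)\<^sup>2" by (simp add: b_def power_mult_distrib)
    then show ?thesis unfolding x_def s2 by algebra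
  qed
  \<comment> \<open>The value 3/4 is exactly where the factor \<open>3 - 4 * m\<close> changes
    sign.\<close>
  have "m \<le> 3 / 4" using assms by (simp add: m_def field_simps)
  moreover have "x \<ge> 0" by (simp add: x_def)
  ultimately have "x * (3 - 4 * m) \<ge> 0" by (intro mult_nonneg_nonneg) auto
  moreover have "a\<^sup>2 + b\<^sup>2 = (1 - m)\<^sup>2 - x * (3 - 4 * m)"
    unfolding a_def p4 b2 m_def[symmetric] by algebra
  ultimately show ?thesis by (simp add: m_def)
qed

text \<open>The squared norm splits into the rotated plane, bounded by
  \<open>rotation_scale_bound\<close>, and the fixed coordinates, where the bound is an equality. A
  basis vector in a fixed direction attains it.\<close>

lemma op_norm_gram:
  assumes n: "CARD('n) \<ge> 3"
  shows "op_norm gram = (real CARD('n) - 1) / (real CARD('n))\<^sup>2"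
proof -
  define a b where "a = c ^ 4 + s ^ 4 - 1 / real CARD('n)" and "b = c * s * (c\<^sup>2 - s\<^sup>2)"
  note gram = gram_mult_vec[folded a_def b_def] and bound = rotation_scale_bound[folded a_def b_def]
  let ?r = "(real CARD('n) - 1) / (real CARD('n))\<^sup>2"
  have r: "?r = (1 - 1 / real CARD('n)) / real CARD('n)"
    using n by (simp add: field_simps power2_eq_square)
  \<comment> \<open>This is where n at least 3 enters: a coordinate outside the plane supplies the
    maximising vector.\<close>
  have "\<exists>k. k \<notin> {i, j}"
  proof (rule ccontr)
    assume "\<nexists>k. k \<notin> {i, j}"
    then have "UNIV = {i, j}" by blast
    then have "CARD('n) = card {i, j}" by simp
    then have "CARD('n) \<le> 2" using ij by simp
    then show False using n by simp
  qed
  then obtain k where k: "k \<noteq> i" "k \<noteq> j" by blast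
  have split: "(\<Sum>p\<in>UNIV. f p) = f i + f j + (\<Sum>p\<in>-{i, j}. f p)" for f :: "'n \<Rightarrow> real"
  proof -
    have "(\<Sum>p\<in>UNIV. f p) = (\<Sum>p\<in>{i, j} \<union> -{i, j}. f p)"
      by (rule sum.cong) auto
    also have "\<dots> = (\<Sum>p\<in>{i, j}. f p) + (\<Sum>p\<in>-{i, j}. f p)"
      by (rule sum.union_disjoint) auto
    finally show ?thesis using ij by simp
  qed
  have sq: "(norm w)\<^sup>2 = (\<Sum>p\<in>UNIV. (cmod (w $ p))\<^sup>2)" for w :: "complex^'n"
    by (simp add: norm_vec_def L2_set_def sum_nonneg)
  \<comment> \<open>A real multiple of a rotation scales norms of complex pairs too: with \<alpha>
    and \<beta> real, the cross terms cancel.\<close>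
  have rot: "(cmod (of_real \<alpha> * x - of_real \<beta> * y))\<^sup>2 + (cmod (of_real \<beta> * x + of_real \<alpha> * y))\<^sup>2
      = (\<alpha>\<^sup>2 + \<beta>\<^sup>2) * ((cmod x)\<^sup>2 + (cmod y)\<^sup>2)" for \<alpha> \<beta> x y
    by (simp add: cmod_power2) algebra
  show ?thesis
  proof (rule op_norm_eqI[where w = "axis k 1"])
    fix v :: "complex^'n"
    have "(norm (gram *v v))\<^sup>2 = ((a\<^sup>2 + b\<^sup>2) * ((cmod (v $ i))\<^sup>2 + (cmod (v $ j))\<^sup>2)) / (real CARD('n))\<^sup>2
        + (\<Sum>p\<in>-{i, j}. ?r\<^sup>2 * (cmod (v $ p))\<^sup>2)"
    proof -
      have "(cmod ((gram *v v) $ i))\<^sup>2 + (cmod ((gram *v v) $ j))\<^sup>2 =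
          ((a\<^sup>2 + b\<^sup>2) * ((cmod (v $ i))\<^sup>2 + (cmod (v $ j))\<^sup>2)) / (real CARD('n))\<^sup>2"
        unfolding rot[symmetric] gram using ij
        by (simp add: norm_divide power_divide add_divide_distrib[of "_\<^sup>2"])
      moreover have "(cmod ((gram *v v) $ p))\<^sup>2 = ?r\<^sup>2 * (cmod (v $ p))\<^sup>2" if "p \<in> -{i, j}" for p
        using that unfolding r
        by (simp add: gram norm_divide norm_mult power_divide power_mult_distrib
            del: of_real_diff of_real_divide)
      ultimately show ?thesis unfolding sq split[of "\<lambda>p. (cmod ((gram *v v) $ p))\<^sup>2"] by simp
    qed
    also have "\<dots> \<le> ?r\<^sup>2 * ((cmod (v $ i))\<^sup>2 + (cmod (v $ j))\<^sup>2) + (\<Sum>p\<in>-{i, j}. ?r\<^sup>2 * (cmod (v $ p))\<^sup>2)"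
    proof -
      have "(a\<^sup>2 + b\<^sup>2) * ((cmod (v $ i))\<^sup>2 + (cmod (v $ j))\<^sup>2) / (real CARD('n))\<^sup>2
          \<le> (1 - 1 / real CARD('n))\<^sup>2 * ((cmod (v $ i))\<^sup>2 + (cmod (v $ j))\<^sup>2) / (real CARD('n))\<^sup>2"
        using n by (intro divide_right_mono mult_right_mono bound) auto
      then show ?thesis unfolding r by (simp add: power_divide)
    qed
    also have "\<dots> = (?r * norm v)\<^sup>2"
      unfolding power_mult_distrib sq split[of "\<lambda>p. (cmod (v $ p))\<^sup>2"]
      by (simp add: distrib_left sum_distrib_left)
    finally show "norm (gram *v v) \<le> ?r * norm v"
      by (rule power2_le_imp_le) (use n in simp)
  next
    \<comment> \<open>The basis vector at k is an eigenvector whose eigenvalue is the claimed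
      norm.\<close>
    have "gram *v axis k 1 = (\<chi> p. of_real ?r * axis k 1 $ p)"
      unfolding r using k by (auto simp: vec_eq_iff gram axis_def)
    then show "norm (gram *v axis k 1) = ?r * norm (axis k (1 :: complex))"
      using n by (simp add: norm_mult_complex_vec del: of_real_divide)
  qed (simp add: axis_eq_0_iff)
qed

lemma interior_angle_plane_rotation:
  assumes "CARD('n) \<ge> 3"
  shows "interior_angle diagonals (conj_alg u diagonals) = 0"
  using assms op_norm_gram
  by (intro interior_angle_eq_0I unitary_plane_rotation) (auto simp: gram_def)

end

theorem mainTheorem12:
  shows "(let u = (vector [vector [1, 0, 0],
                           vector [0, of_real (sqrt 3 / 2), 1 / 2],
                           vector [0, - (1 / 2), of_real (sqrt 3 / 2)]] :: complex^3^3)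
          in unitary u \<and>
             diagonals \<noteq> conj_alg u diagonals \<and>
             interior_angle diagonals (conj_alg u diagonals) = 0)
       \<and> (CARD('n::finite) \<ge> 3 \<longrightarrow>
            (\<exists>u :: complex^'n^'n. unitary u \<and>
               diagonals \<noteq> conj_alg u diagonals \<and>
               interior_angle diagonals (conj_alg u diagonals) = 0))"
proof -
  have cs: "(sqrt 3 / 2)\<^sup>2 + (1 / 2)\<^sup>2 = (1 :: real)" by (simp add: power_divide)
  \<comment> \<open>Here c and s are the cosine and sine of pi/6, the plane is that of indices 2 and
    3, and index 1 is the fixed coordinate.\<close>
  have u3: "(vector [vector [1, 0, 0],
      vector [0, of_real (sqrt 3 / 2), 1 / 2],
      vector [0, - (1 / 2), of_real (sqrt 3 / 2)]] :: complex^3^3)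
    = plane_rotation 2 3 (sqrt 3 / 2) (1 / 2)"
    by (simp add: vec_eq_iff forall_3 plane_rotation_def)
  interpret R: coordinate_plane "2 :: 3" 3 "sqrt 3 / 2" "1 / 2"
    by unfold_locales (use cs in simp_all)
  have "\<exists>u :: complex^'n^'n. unitary u \<and> diagonals \<noteq> conj_alg u diagonals \<and>
      interior_angle diagonals (conj_alg u diagonals) = 0" if n: "CARD('n) \<ge> 3"
  proof -
    \<comment> \<open>Any two distinct indices serve: the same c and s are both nonzero, so the
      algebras differ in every dimension.\<close>
    obtain i j :: 'n where "i \<noteq> j"
    proof -
      obtain S :: "'n set" where "card S = 2" using n ex_card[of 2 "UNIV :: 'n set"] by auto
      then show ?thesis using that by (auto simp: card_2_iff)
    qed
    then interpret coordinate_plane i j "sqrt 3 / 2" "1 / 2"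
      by unfold_locales (use cs in simp_all)
    show ?thesis
      using unitary_plane_rotation diagonals_ne_conj interior_angle_plane_rotation[OF n] by auto
  qed
  then show ?thesis
    unfolding Let_def u3
    using R.unitary_plane_rotation R.diagonals_ne_conj R.interior_angle_plane_rotation by simp
qed

end
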